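(* For every $s\in S$, let $\Xi_s\subset A\times B$ be nonempty and, for every $(a,b)\in\Xi_s$, let $d_{ab}^s\in\mathbb{R}$. Let $\eta\ge 0$, let $\Delta_\Xi=\prod_{s\in S}\Delta(\Xi_s)$, and consider the problem $$(P_\Xi)\qquad \min_{q\in\Delta_\Xi}F(q,\eta):=g_\Xi(q)+\eta\sum_{s\in S}\sum_{(a,b)\in\Xi_s}d_{ab}^s q_{ab}^s .$$ Then the following hold. 1. The set of solutions to $(P_\Xi)$ is nonempty. 2. Given $q^0\in\mathrm{ri}(\Delta_\Xi)$ (relative interior), consider the sequence $(q^n)_{n\in\mathbb{N}}$ generated by the recurrence $$(\forall n\in\mathbb{N})(\forall s\in S)(\forall (a,b)\in\Xi_s)\quad q_{ab}^{n+1,s}=\frac{(T_\Xi(q^n))_b\,e^{-\eta d_{ab}^s/p_s}}{\sum_{(a',b')\in\Xi_s}(T_\Xi(q^n))_{b'}\,e^{-\eta d_{a'b'}^s/p_s}} .$$ Then: (a) For every solution $\overline{q}$ to $(P_\Xi)$ and every $n\in\mathbb{N}$, $$0\le n\big(F(q^n,\eta)-F(\overline{q},\eta)\big)+\sum_{k=0}^{n-1}D_B\big(T_\Xi(q^{k+1}),T_\Xi(q^k)\big)\le\sum_{s\in S}p_sD_{A\times B}(\overline{q}^s,q^{0,s}).$$ (b) For every solution $\overline{q}$ to $(P_\Xi)$ and every integer $n\ge 1$, $$0\le F(q^n,\eta)-F(\overline{q},\eta)\le\frac1n\sum_{s\in S}p_sD_{A\times B}(\overline{q}^s,q^{0,s}),$$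 and $\sum_{k=1}^{\infty}D_B\big(T_\Xi(q^{k+1}),T_\Xi(q^k)\big)<+\infty$. (c) The sequence $(q^n)_{n\in\mathbb{N}}$ converges to some solution $\overline{q}$ to $(P_\Xi)$.
   Context: $A,B,S$ are nonempty finite sets with $|A|\ge 2$, and $p=(p_s)_{s\in S}$ is a probability distribution on $S$ with $p_s>0$ for all $s\in S$. For a nonempty finite set $I$, $\Delta(I)=\{x\in[0,1]^I:\sum_{i\in I}x_i=1\}$. Define $\psi:\mathbb{R}^2\to\,]-\infty,+\infty]$ by $\psi(\xi,\mu)=\xi\ln(\xi/\mu)$ if $\xi>0$ and $\mu>0$; $\psi(0,\mu)=0$ if $\mu\ge0$; and $\psi(\xi,\mu)=+\infty$ otherwise. For a finite set $I$ and $q,u\in\mathbb{R}^I$, $D_I(q,u)=\sum_{i\in I}\psi(q_i,u_i)$. Points $q=(q^s)_{s\in S}\in\prod_{s\in S}\mathbb{R}^{\Xi_s}$ have components $q_{ab}^s$, $(a,b)\in\Xi_s$, $s\in S$; the components of the iterate $q^n$ are written $q_{ab}^{n,s}$ and $q^{n,s}=(q^{n,s}_{ab})_{(a,b)}$. Whenever needed, such a $q$ is identified with its extension by zero, i.e. $q_{ab}^s=0$ for $(a,b)\in(A\times B)\setminus\Xi_s$ (so $\overline{q}^s$ and $q^{0,s}$ are viewed as elements of $\mathbb{R}^{A\times B}$ in $D_{A\times B}(\overline{q}^s,q^{0,s})$). The function $g:(\mathbb{R}^{A\times B})^S\to\,]-\infty,+\infty]$ is $$g(q)=\sum_{s\in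 S}p_s\sum_{a\in A}\sum_{b\in B}\psi\Big(q_{ab}^s,\sum_{a'\in A}\sum_{s'\in S}p_{s'}q_{a'b}^{s'}\Big)$$ if all components of $q$ are nonnegative, and $g(q)=+\infty$ otherwise. The function $g_\Xi$ is the restriction of $g$ to points $q$ with nonnegative components indexed by $(a,b)\in\Xi_s$, $s\in S$ (extended by zero, i.e. by setting $q_{ab}^s=0$ for every $s\in S$ and $(a,b)\in(A\times B)\setminus\Xi_s$). The map $T_\Xi:\Delta_\Xi\to\Delta(B)$ is $T_\Xi(q)=\Big(\sum_{a\in A}\sum_{s\in S}p_sq_{ab}^s\Big)_{b\in B}$ (with the extension by zero). *)

theory Defs
  imports "HOL-Analysis.Analysis"
begin

text \<open>
  The finite sets \<open>A\<close>, \<open>B\<close>, \<open>S\<close> are the (finite, nonempty) types \<open>'a\<close>, \<open>'b\<close>, \<open>'s\<close>.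
  Vectors indexed by a subset \<open>I\<close> of a finite type are identified with their extension by
  zero: \<open>\<real>\<^sup>I\<close> is the subspace of \<open>real ^ 'i\<close> of vectors that vanish outside \<open>I\<close>.
\<close>

definition psi :: "real \<Rightarrow> real \<Rightarrow> ereal" where
  "psi \<xi> \<mu> =
    (if \<xi> > 0 \<and> \<mu> > 0 then ereal (\<xi> * ln (\<xi> / \<mu>))
     else if \<xi> = 0 \<and> \<mu> \<ge> 0 then 0
     else \<infinity>)"

definition Dkl :: "real ^ 'i \<Rightarrow> real ^ 'i \<Rightarrow> ereal" where
  "Dkl q u = (\<Sum>i\<in>UNIV. psi (q $ i) (u $ i))"

definition Delta :: "'i set \<Rightarrow> (real ^ 'i) set" where
  "Delta I = {x. (\<forall>i\<in>I. 0 \<le> x $ i \<and> x $ i \<le> 1) \<and> (\<forall>i. i \<notin> I \<longrightarrow> x $ i = 0)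
                 \<and> (\<Sum>i\<in>I. x $ i) = 1}"

text \<open>The product of the spaces \<open>\<real>\<^sup>I\<close> with \<open>I = \<Xi> s\<close>, for \<open>s\<close> in \<open>S\<close>.\<close>

definition point_space :: "('s \<Rightarrow> ('a \<times> 'b) set) \<Rightarrow>
    ((real ^ ('a::finite \<times> 'b::finite)) ^ 's::finite) set" where
  "point_space \<Xi> = {q. \<forall>s ab. ab \<notin> \<Xi> s \<longrightarrow> q $ s $ ab = 0}"

definition Delta_Xi :: "('s \<Rightarrow> ('a \<times> 'b) set) \<Rightarrow>
    ((real ^ ('a::finite \<times> 'b::finite)) ^ 's::finite) set" where
  "Delta_Xi \<Xi> = {q. \<forall>s. q $ s \<in> Delta (\<Xi> s)}"

definition g :: "real ^ 's \<Rightarrow> (real ^ ('a::finite \<times> 'b::finite)) ^ 's::finite \<Rightarrow> ereal" where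
  "g p q =
    (if \<forall>s a b. 0 \<le> q $ s $ (a, b)
     then \<Sum>s\<in>UNIV. ereal (p $ s) *
            (\<Sum>a\<in>UNIV. \<Sum>b\<in>UNIV.
               psi (q $ s $ (a, b)) (\<Sum>a'\<in>UNIV. \<Sum>s'\<in>UNIV. p $ s' * q $ s' $ (a', b)))
     else \<infinity>)"

definition T :: "real ^ 's \<Rightarrow> (real ^ ('a::finite \<times> 'b::finite)) ^ 's::finite \<Rightarrow> real ^ 'b" where
  "T p q = (\<chi> b. \<Sum>a\<in>UNIV. \<Sum>s\<in>UNIV. p $ s * q $ s $ (a, b))"

text \<open>
  \<open>F\<close> and \<open>T\<close> are only meant to be evaluated on \<open>point_space \<Xi>\<close>; there, \<open>g\<close> and
  \<open>T\<close> coincide with the restrictions \<open>g\<^sub>\<Xi>\<close> and \<open>T\<^sub>\<Xi>\<close>, because points are already extended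
  by zero.  The values of \<open>d s\<close> outside \<open>\<Xi> s\<close> play no role.
\<close>

definition F :: "real ^ 's \<Rightarrow> ('s \<Rightarrow> ('a \<times> 'b) set) \<Rightarrow> ('s \<Rightarrow> 'a \<Rightarrow> 'b \<Rightarrow> real) \<Rightarrow>
    (real ^ ('a::finite \<times> 'b::finite)) ^ 's::finite \<Rightarrow> real \<Rightarrow> ereal" where
  "F p \<Xi> d q \<eta> =
     g p q + ereal (\<eta> * (\<Sum>s\<in>UNIV. \<Sum>(a, b)\<in>\<Xi> s. d s a b * q $ s $ (a, b)))"

definition solutions :: "real ^ 's \<Rightarrow> ('s \<Rightarrow> ('a \<times> 'b) set) \<Rightarrow> ('s \<Rightarrow> 'a \<Rightarrow> 'b \<Rightarrow> real) \<Rightarrow>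
    real \<Rightarrow> ((real ^ ('a::finite \<times> 'b::finite)) ^ 's::finite) set" where
  "solutions p \<Xi> d \<eta> = {q. is_arg_min (\<lambda>q'. F p \<Xi> d q' \<eta>) (\<lambda>q'. q' \<in> Delta_Xi \<Xi>) q}"

end

theory Submission
  imports Defs "HOL-Real_Asymp.Real_Asymp"
begin

text \<open>
  Write \<open>\<Phi>(u, q)\<close> for the objective in which the marginal \<open>T q\<close> inside the logarithm is
  replaced by a free \<open>u\<close>. Then \<open>\<Phi>(u, q) = F q + D(T q, u)\<close>, and for fixed \<open>u = T q\<^sup>n\<close> the
  minimizer of \<open>\<Phi>(u, \<cdot>)\<close> is the Gibbs point \<open>q\<^sup>n\<^sup>+\<^sup>1\<close>, with gap exactly
  \<open>E(q, q\<^sup>n\<^sup>+\<^sup>1) = \<Sum>\<^sub>s p\<^sub>s D(q\<^sup>s, q\<^sup>n\<^sup>+\<^sup>1\<^sup>,\<^sup>s)\<close>. Hence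
  \<open>F q + D(T q, T q\<^sup>n) = F q\<^sup>n\<^sup>+\<^sup>1 + D(T q\<^sup>n\<^sup>+\<^sup>1, T q\<^sup>n) + E(q, q\<^sup>n\<^sup>+\<^sup>1)\<close>, and the log-sum inequality
  \<open>D(T q, T q\<^sup>n) \<le> E(q, q\<^sup>n)\<close> makes the estimate telescope. It also shows that \<open>E(q, q\<^sup>n)\<close>
  decreases for every solution \<open>q\<close>; applied to a cluster point of the iterates, which is a
  solution by the rate estimate, \<open>E(q, q\<^sup>n)\<close> tends to \<open>0\<close>, and \<open>E\<close> dominates the squared
  distance.
\<close>

section \<open>Relative entropy of real numbers\<close>

text \<open>The third hypothesis excludes the infinite branch, and at \<open>x = 0\<close> the
  factor \<open>x\<close> makes the value of \<open>ln\<close> irrelevant.\<close>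

lemma psi_eq_real:
  assumes "0 \<le> x" "0 \<le> y" "y = 0 \<Longrightarrow> x = 0"
  shows "psi x y = ereal (x * ln (x / y))"
  using assms by (auto simp: psi_def)

text \<open>Apply \<open>ln t \<le> t - 1\<close> at \<open>t = sqrt (y / x)\<close> and multiply by
  \<open>2 * x\<close>. The square root is what leaves a squared Hellinger distance as remainder,
  where \<open>t = y / x\<close> would leave only \<open>0\<close>.\<close>

lemma hellinger_le_entropy:
  fixes x y :: real
  assumes "0 \<le> x" "0 \<le> y" "y = 0 \<Longrightarrow> x = 0"
  shows "(sqrt x - sqrt y)\<^sup>2 \<le> x * ln (x / y) - x + y"
proof (cases "x = 0")
  case False
  with assms have pos: "x > 0" "y > 0" by (auto simp: less_le)
  have "ln (sqrt (y / x)) \<le> sqrt (y / x) - 1"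
    using pos by (intro ln_le_minus_one) simp
  then have "x * ln (sqrt (y / x)) \<le> x * (sqrt (y / x) - 1)"
    using pos by (intro mult_left_mono) auto
  moreover have "ln (sqrt (y / x)) = - ln (x / y) / 2"
    using pos by (simp add: ln_sqrt ln_div)
  moreover have "x * sqrt (y / x) = sqrt x * sqrt y"
    using pos by (simp add: real_sqrt_divide field_simps)
  moreover have "(sqrt x)\<^sup>2 = x" "(sqrt y)\<^sup>2 = y"
    using pos by auto
  ultimately show ?thesis
    by (simp add: power2_diff algebra_simps)
qed (use assms in auto)

lemma entropy_ge:
  fixes x y :: real
  assumes "0 \<le> x" "0 \<le> y" "y = 0 \<Longrightarrow> x = 0"
  shows "x - y \<le> x * ln (x / y)"
  using hellinger_le_entropy[OF assms] zero_le_power2[of "sqrt x - sqrt y"] by linarith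

text \<open>Factor \<open>x - y\<close> through square roots: on the unit interval the second factor
  is at most 2, whence the constant 4. Summed over coordinates this becomes a Pinsker-type
  bound.\<close>

lemma square_le_entropy:
  fixes x y :: real
  assumes "0 \<le> x" "x \<le> 1" "0 \<le> y" "y \<le> 1" "y = 0 \<Longrightarrow> x = 0"
  shows "(x - y)\<^sup>2 \<le> 4 * (x * ln (x / y) - x + y)"
proof -
  have "x - y = (sqrt x - sqrt y) * (sqrt x + sqrt y)"
    using assms by (simp add: algebra_simps)
  then have "(x - y)\<^sup>2 = (sqrt x - sqrt y)\<^sup>2 * (sqrt x + sqrt y)\<^sup>2"
    by (simp add: power_mult_distrib)
  also have "\<dots> \<le> (sqrt x - sqrt y)\<^sup>2 * 2\<^sup>2"
  proof (intro mult_left_mono power_mono)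
    have "sqrt x \<le> 1" "sqrt y \<le> 1" using assms by simp_all
    then show "sqrt x + sqrt y \<le> 2" by linarith
  qed (use assms in simp_all)
  also have "\<dots> \<le> 4 * (x * ln (x / y) - x + y)"
    using hellinger_le_entropy[OF assms(1,3,5)] by (simp add: mult.commute)
  finally show ?thesis .
qed

text \<open>With totals \<open>X\<close> and \<open>Y\<close>, bound each term by
  \<open>entropy_ge\<close> against the rescaled \<open>y i * (X / Y)\<close>. The linear
  corrections then sum to \<open>X - Y * (X / Y) = 0\<close>.\<close>

lemma log_sum_inequality:
  fixes x y :: "'i \<Rightarrow> real"
  assumes "finite I" and nonneg: "\<And>i. i \<in> I \<Longrightarrow> 0 \<le> x i" "\<And>i. i \<in> I \<Longrightarrow> 0 \<le> y i"
    and abs_cont: "\<And>i. i \<in> I \<Longrightarrow> y i = 0 \<Longrightarrow> x i = 0"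
  shows "sum x I * ln (sum x I / sum y I) \<le> (\<Sum>i\<in>I. x i * ln (x i / y i))"
proof (cases "sum x I = 0")
  case True
  then have "\<And>i. i \<in> I \<Longrightarrow> x i = 0"
    using nonneg(1) \<open>finite I\<close> by (simp add: sum_nonneg_eq_0_iff)
  with True show ?thesis by simp
next
  case False
  define X where "X = sum x I"
  define Y where "Y = sum y I"
  have X: "X > 0"
    using False nonneg(1) sum_nonneg[of I x] by (auto simp: X_def less_le)
  have "Y \<noteq> 0"
  proof
    assume "Y = 0"
    then have "\<And>i. i \<in> I \<Longrightarrow> y i = 0"
      using nonneg(2) \<open>finite I\<close> by (simp add: Y_def sum_nonneg_eq_0_iff)
    with abs_cont False show False by simp
  qed
  then have Y: "Y > 0"
    using nonneg(2) sum_nonneg[of I y] by (auto simp: Y_def less_le)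
  have "x i * ln (X / Y) + (x i - y i * (X / Y)) \<le> x i * ln (x i / y i)" if "i \<in> I" for i
  proof (cases "x i = 0")
    case True
    then show ?thesis using X Y nonneg(2)[OF that] by simp
  next
    case False
    then have pos: "x i > 0" "y i > 0"
      using nonneg[OF that] abs_cont[OF that] by (auto simp: less_le)
    have "x i - y i * (X / Y) \<le> x i * ln (x i / (y i * (X / Y)))"
      using pos X Y by (intro entropy_ge) auto
    also have "ln (x i / (y i * (X / Y))) = ln (x i / y i) - ln (X / Y)"
      using pos X Y by (simp add: ln_div ln_mult)
    finally show ?thesis by (simp add: algebra_simps)
  qed
  then have "(\<Sum>i\<in>I. x i * ln (X / Y) + (x i - y i * (X / Y))) \<le> (\<Sum>i\<in>I. x i * ln (x i / y i))"
    by (rule sum_mono)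
  also have "(\<Sum>i\<in>I. x i * ln (X / Y) + (x i - y i * (X / Y))) = X * ln (X / Y) + (X - Y * (X / Y))"
    by (simp only: sum.distrib sum_subtractf sum_distrib_right[symmetric] X_def Y_def)
  finally show ?thesis using Y by (simp add: X_def Y_def)
qed

lemma continuous_on_x_ln_x: "continuous_on {0..} (\<lambda>x::real. x * ln x)"
  unfolding continuous_on_def
proof
  fix x :: real assume "x \<in> {0..}"
  show "((\<lambda>x. x * ln x) \<longlongrightarrow> x * ln x) (at x within {0..})"
  proof (cases "x = 0")
    case True
    have "((\<lambda>x::real. x * ln x) \<longlongrightarrow> 0) (at_right 0)"
      by real_asymp
    moreover have "at (0::real) within {0..} = at_right 0"
      by (rule at_within_Ici_at_right)
    ultimately show ?thesis using True by simp
  next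
    case False
    with \<open>x \<in> {0..}\<close> have "isCont (\<lambda>x. x * ln x) x"
      by (intro continuous_intros) auto
    then show ?thesis
      unfolding isCont_def by (rule tendsto_within_subset) simp
  qed
qed

section \<open>Relative entropy of vectors\<close>

definition kl :: "real ^ 'i \<Rightarrow> real ^ 'i \<Rightarrow> real" where
  "kl x y = (\<Sum>i\<in>UNIV. x $ i * ln (x $ i / y $ i))"

lemma kl_self [simp]: "kl x x = 0"
  by (auto simp: kl_def intro!: sum.neutral)

text \<open>Absolute continuity matters here: where \<open>y\<close> vanishes and \<open>x\<close>
  does not, \<open>Dkl\<close> is infinite but \<open>kl\<close> stays real.\<close>

lemma Dkl_eq_kl:
  assumes "\<And>i. 0 \<le> x $ i" "\<And>i. 0 \<le> y $ i" "\<And>i. y $ i = 0 \<Longrightarrow> x $ i = 0"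
  shows "Dkl x y = ereal (kl x y)"
  unfolding Dkl_def kl_def using assms by (simp add: psi_eq_real)

text \<open>With equal totals the left side of the log-sum inequality vanishes: the logarithm is
  \<open>ln 1\<close>, or its factor is 0 when both totals are 0.\<close>

lemma kl_nonneg:
  fixes x y :: "real ^ 'i::finite"
  assumes "\<And>i. 0 \<le> x $ i" "\<And>i. 0 \<le> y $ i" "\<And>i. y $ i = 0 \<Longrightarrow> x $ i = 0"
    and "(\<Sum>i\<in>UNIV. x $ i) = (\<Sum>i\<in>UNIV. y $ i)"
  shows "0 \<le> kl x y"
  using log_sum_inequality[of UNIV "($) x" "($) y"] assms by (cases "sum (($) y) UNIV = 0") (auto simp: kl_def)

lemma square_le_kl:
  fixes x y :: "real ^ 'i::finite"
  assumes "\<And>i. 0 \<le> x $ i" "\<And>i. x $ i \<le> 1" "\<And>i. 0 \<le> y $ i" "\<And>i. y $ i \<le> 1"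
    and "\<And>i. y $ i = 0 \<Longrightarrow> x $ i = 0"
    and "(\<Sum>i\<in>UNIV. x $ i) = (\<Sum>i\<in>UNIV. y $ i)"
  shows "(x $ j - y $ j)\<^sup>2 \<le> 4 * kl x y"
proof -
  have "(x $ j - y $ j)\<^sup>2 \<le> (\<Sum>i\<in>UNIV. (x $ i - y $ i)\<^sup>2)"
    by (rule member_le_sum) auto
  also have "\<dots> \<le> (\<Sum>i\<in>UNIV. 4 * (x $ i * ln (x $ i / y $ i) - x $ i + y $ i))"
    using assms by (intro sum_mono square_le_entropy) auto
  \<comment> \<open>Equal totals cancel the linear terms.\<close>
  also have "\<dots> = 4 * kl x y"
    by (simp add: kl_def sum.distrib sum_subtractf assms(6) flip: sum_distrib_left)
  finally show ?thesis .
qed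

text \<open>Only the second argument moves. Coordinates with \<open>x $ i = 0\<close> contribute 0
  identically; at the others the ratio tends to 1.\<close>

lemma tendsto_kl_self:
  fixes x :: "real ^ 'i::finite" and y :: "nat \<Rightarrow> real ^ 'i"
  assumes "y \<longlonglongrightarrow> x"
  shows "(\<lambda>n. kl x (y n)) \<longlonglongrightarrow> 0"
proof -
  have "(\<lambda>n. x $ i * ln (x $ i / y n $ i)) \<longlonglongrightarrow> 0" for i
  proof (cases "x $ i = 0")
    case False
    then have "(\<lambda>n. x $ i * ln (x $ i / y n $ i)) \<longlonglongrightarrow> x $ i * ln (x $ i / x $ i)"
      by (intro tendsto_intros tendsto_vec_nth assms) auto
    with False show ?thesis by simp
  qed simp
  then have "(\<lambda>n. kl x (y n)) \<longlonglongrightarrow> (\<Sum>i\<in>(UNIV::'i set). 0)"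
    unfolding kl_def by (rule tendsto_sum)
  then show ?thesis by simp
qed

section \<open>Products of simplices\<close>

lemma Delta_XiD:
  assumes "q \<in> Delta_Xi \<Xi>"
  shows "0 \<le> q $ s $ i" "q $ s $ i \<le> 1" "i \<notin> \<Xi> s \<Longrightarrow> q $ s $ i = 0"
    "(\<Sum>i\<in>\<Xi> s. q $ s $ i) = 1" "(\<Sum>i\<in>UNIV. q $ s $ i) = 1"
proof -
  have q: "q $ s \<in> Delta (\<Xi> s)"
    using assms by (simp add: Delta_Xi_def)
  have supp: "q $ s $ j = 0" if "j \<notin> \<Xi> s" for j
    using q that unfolding Delta_def by blast
  then show "q $ s $ i = 0" if "i \<notin> \<Xi> s" using that .
  show sum: "(\<Sum>i\<in>\<Xi> s. q $ s $ i) = 1"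
    using q unfolding Delta_def by blast
  have "0 \<le> q $ s $ i \<and> q $ s $ i \<le> 1" if "i \<in> \<Xi> s"
    using q that unfolding Delta_def by blast
  with supp[of i] show "0 \<le> q $ s $ i" "q $ s $ i \<le> 1"
    by fastforce+
  have "(\<Sum>i\<in>\<Xi> s. q $ s $ i) = (\<Sum>i\<in>UNIV. q $ s $ i)"
    using supp by (intro sum.mono_neutral_left) auto
  with sum show "(\<Sum>i\<in>UNIV. q $ s $ i) = 1" by simp
qed

lemma Delta_XiI:
  assumes "\<And>s i. 0 \<le> q $ s $ i" "\<And>s i. i \<notin> \<Xi> s \<Longrightarrow> q $ s $ i = 0"
    "\<And>s. (\<Sum>i\<in>\<Xi> s. q $ s $ i) = 1"
  shows "q \<in> Delta_Xi \<Xi>"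
  unfolding Delta_Xi_def Delta_def
proof (clarify, intro conjI ballI allI impI)
  fix s i assume "i \<in> \<Xi> s"
  then have "q $ s $ i \<le> (\<Sum>i\<in>\<Xi> s. q $ s $ i)"
    using assms(1) by (intro member_le_sum) auto
  then show "q $ s $ i \<le> 1" using assms(3) by simp
qed (use assms in auto)

lemma Delta_Xi_eq:
  "Delta_Xi \<Xi> = {q. (\<forall>s i. 0 \<le> q $ s $ i) \<and> (\<forall>s i. i \<notin> \<Xi> s \<longrightarrow> q $ s $ i = 0)
      \<and> (\<forall>s. (\<Sum>i\<in>\<Xi> s. q $ s $ i) = 1)}"
  by (auto intro: Delta_XiI simp: Delta_XiD)

lemma compact_Delta_Xi:
  fixes \<Xi> :: "'s::finite \<Rightarrow> ('a::finite \<times> 'b::finite) set"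
  shows "compact (Delta_Xi \<Xi>)"
proof (rule compact_eq_bounded_closed[THEN iffD2], intro conjI)
  show "closed (Delta_Xi \<Xi>)"
    unfolding Delta_Xi_eq
    by (intro closed_Collect_conj closed_Collect_all closed_Collect_imp open_Collect_const
          closed_Collect_le closed_Collect_eq continuous_intros)
  show "bounded (Delta_Xi \<Xi>)"
  proof (rule boundedI)
    fix q assume q: "q \<in> Delta_Xi \<Xi>"
    have "norm q \<le> (\<Sum>s\<in>UNIV. norm (q $ s))"
      unfolding norm_vec_def[of q] by (rule L2_set_le_sum) simp
    also have "\<dots> \<le> (\<Sum>s\<in>(UNIV::'s set). 1)"
    proof (rule sum_mono)
      fix s
      have "norm (q $ s) \<le> (\<Sum>i\<in>UNIV. \<bar>q $ s $ i\<bar>)"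
        by (rule norm_le_l1_cart)
      also have "\<dots> = 1"
        using Delta_XiD(1,5)[OF q] by simp
      finally show "norm (q $ s) \<le> 1" .
    qed
    finally show "norm q \<le> (\<Sum>s\<in>(UNIV::'s set). 1)" .
  qed
qed

lemma convex_Delta_Xi: "convex (Delta_Xi \<Xi>)"
proof (rule convexI)
  fix x y and u v :: real
  assume xy: "x \<in> Delta_Xi \<Xi>" "y \<in> Delta_Xi \<Xi>" and uv: "0 \<le> u" "0 \<le> v" "u + v = 1"
  show "u *\<^sub>R x + v *\<^sub>R y \<in> Delta_Xi \<Xi>"
    by (rule Delta_XiI) (use uv in \<open>auto simp: Delta_XiD[OF xy(1)] Delta_XiD[OF xy(2)] sum.distrib
          simp flip: sum_distrib_left\<close>)
qed

text \<open>A relative interior point can be pushed slightly past itself, away from any point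
  \<open>c\<close> of the set. If \<open>c\<close> is positive at \<open>i\<close>, nonnegativity of
  the pushed point forces \<open>q\<close> to be positive there.\<close>

lemma rel_interior_Delta_Xi_pos:
  assumes ne: "\<And>s. \<Xi> s \<noteq> {}" and q: "q \<in> rel_interior (Delta_Xi \<Xi>)" and i: "i \<in> \<Xi> s"
  shows "0 < q $ s $ i"
proof -
  \<comment> \<open>Uniform distribution on each support, positive at all admissible coordinates at
    once.\<close>
  define c where "c = (\<chi> s. \<chi> i. if i \<in> \<Xi> s then 1 / real (card (\<Xi> s)) else 0)"
  have c: "c \<in> Delta_Xi \<Xi>"
    by (rule Delta_XiI) (use ne in \<open>auto simp: c_def\<close>)
  obtain e where e: "e > 1" "(1 - e) *\<^sub>R c + e *\<^sub>R q \<in> Delta_Xi \<Xi>"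
    using convex_rel_interior_iff[OF convex_Delta_Xi] q c by blast
  have "0 \<le> (1 - e) * c $ s $ i + e * q $ s $ i"
    using Delta_XiD(1)[OF e(2), of s i] by simp
  moreover have "0 < (e - 1) * c $ s $ i"
    using e(1) i ne[of s] by (auto simp: c_def card_gt_0_iff)
  ultimately have "0 < e * q $ s $ i"
    by (simp add: algebra_simps)
  with e(1) show ?thesis
    by (simp add: zero_less_mult_iff)
qed

section \<open>Sums against the marginal\<close>

lemma sum_UNIV_prod: "(\<Sum>i\<in>(UNIV :: ('a::finite \<times> 'b::finite) set). h i) = (\<Sum>a\<in>UNIV. \<Sum>b\<in>UNIV. h (a, b))"
  by (simp add: sum.cartesian_product case_prod_unfold)

text \<open>The adjoint of \<open>T\<close>: averaging a function of \<open>b\<close> alone against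
  the marginal is averaging it against \<open>q\<close>. It serves to pull logarithms of marginals
  out of the objective.\<close>

lemma sum_T:
  fixes q :: "(real ^ ('a::finite \<times> 'b::finite)) ^ 's::finite"
  shows "(\<Sum>b\<in>UNIV. T p q $ b * h b) = (\<Sum>s\<in>UNIV. p $ s * (\<Sum>i\<in>UNIV. q $ s $ i * h (snd i)))"
proof -
  have "(\<Sum>b\<in>UNIV. T p q $ b * h b)
      = (\<Sum>b\<in>UNIV. \<Sum>a\<in>UNIV. \<Sum>s\<in>UNIV. p $ s * q $ s $ (a, b) * h b)"
    by (simp add: T_def sum_distrib_right)
  also have "\<dots> = (\<Sum>a\<in>UNIV. \<Sum>s\<in>UNIV. \<Sum>b\<in>UNIV. p $ s * q $ s $ (a, b) * h b)"
    by (subst sum.swap, intro sum.cong refl, subst sum.swap, rule refl)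
  also have "\<dots> = (\<Sum>s\<in>UNIV. \<Sum>a\<in>UNIV. \<Sum>b\<in>UNIV. p $ s * q $ s $ (a, b) * h b)"
    by (rule sum.swap)
  finally show ?thesis
    by (simp add: sum_UNIV_prod sum_distrib_left mult.assoc)
qed

section \<open>Alternating minimization\<close>

locale rate_problem =
  fixes p :: "real ^ 's::finite"
    and \<Xi> :: "'s \<Rightarrow> ('a::finite \<times> 'b::finite) set"
    and d :: "'s \<Rightarrow> 'a \<Rightarrow> 'b \<Rightarrow> real"
    and \<eta> :: real
  assumes p_pos: "0 < p $ s" and \<Xi>_nonempty: "\<Xi> s \<noteq> {}"
begin

text \<open>Dividing by \<open>p $ s\<close> lets the linear term enter the
  \<open>p\<close>-weighted sum in \<open>Phi\<close>; it is also the exponent in the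
  recurrence.\<close>

definition cost :: "'s \<Rightarrow> 'a \<times> 'b \<Rightarrow> real" where
  "cost s i = \<eta> * d s (fst i) (snd i) / p $ s"

definition Phi :: "real ^ 'b \<Rightarrow> (real ^ ('a \<times> 'b)) ^ 's \<Rightarrow> real" where
  "Phi u q = (\<Sum>s\<in>UNIV. p $ s * (\<Sum>i\<in>UNIV. q $ s $ i * (ln (q $ s $ i / u $ snd i) + cost s i)))"

definition f :: "(real ^ ('a \<times> 'b)) ^ 's \<Rightarrow> real" where
  "f q = Phi (T p q) q"

definition divergence :: "(real ^ ('a \<times> 'b)) ^ 's \<Rightarrow> (real ^ ('a \<times> 'b)) ^ 's \<Rightarrow> real" where
  "divergence x y = (\<Sum>s\<in>UNIV. p $ s * kl (x $ s) (y $ s))"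

text \<open>Unnormalized Gibbs weight; \<open>Z\<close> is the corresponding partition
  function.\<close>

definition weight :: "real ^ 'b \<Rightarrow> 's \<Rightarrow> 'a \<times> 'b \<Rightarrow> real" where
  "weight u s i = u $ snd i * exp (- cost s i)"

definition Z :: "real ^ 'b \<Rightarrow> 's \<Rightarrow> real" where
  "Z u s = (\<Sum>i\<in>\<Xi> s. weight u s i)"

definition step :: "(real ^ ('a \<times> 'b)) ^ 's \<Rightarrow> (real ^ ('a \<times> 'b)) ^ 's" where
  "step y = (\<chi> s. \<chi> i. if i \<in> \<Xi> s then weight (T p y) s i / Z (T p y) s else 0)"

text \<open>Positivity on the supports holds in the relative interior and is preserved by
  \<open>step\<close>. A second argument of this kind makes every relative entropy below
  finite.\<close>

definition pos_points :: "((real ^ ('a \<times> 'b)) ^ 's) set" where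
  "pos_points = {q \<in> Delta_Xi \<Xi>. \<forall>s. \<forall>i\<in>\<Xi> s. 0 < q $ s $ i}"

section \<open>Positivity, absolute continuity and comparison of divergences\<close>

lemma p_nonneg: "0 \<le> p $ s" and p_nonzero: "p $ s \<noteq> 0"
  using p_pos[of s] by auto

lemma pos_points_Delta: "q \<in> pos_points \<Longrightarrow> q \<in> Delta_Xi \<Xi>"
  by (simp add: pos_points_def)

lemma pos_points_pos: "q \<in> pos_points \<Longrightarrow> i \<in> \<Xi> s \<Longrightarrow> 0 < q $ s $ i"
  by (simp add: pos_points_def)

lemma pos_points_abs_cont:
  "x \<in> Delta_Xi \<Xi> \<Longrightarrow> y \<in> pos_points \<Longrightarrow> y $ s $ i = 0 \<Longrightarrow> x $ s $ i = 0"
  by (metis Delta_XiD(3) pos_points_pos less_irrefl)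

lemma T_ge:
  assumes "q \<in> Delta_Xi \<Xi>"
  shows "p $ s * q $ s $ (a, b) \<le> T p q $ b"
proof -
  have nonneg: "0 \<le> p $ s' * q $ s' $ (a', b)" for s' a'
    using Delta_XiD(1)[OF assms] p_pos[of s'] by simp
  have "p $ s * q $ s $ (a, b) \<le> (\<Sum>s'\<in>UNIV. p $ s' * q $ s' $ (a, b))"
    using nonneg by (intro member_le_sum) auto
  also have "\<dots> \<le> (\<Sum>a'\<in>UNIV. \<Sum>s'\<in>UNIV. p $ s' * q $ s' $ (a', b))"
    using nonneg by (intro member_le_sum[of a UNIV "\<lambda>a'. \<Sum>s'\<in>UNIV. p $ s' * q $ s' $ (a', b)"] sum_nonneg) auto
  finally show ?thesis by (simp add: T_def)
qed

lemma T_nonneg: "q \<in> Delta_Xi \<Xi> \<Longrightarrow> 0 \<le> T p q $ b"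
  by (simp add: T_def sum_nonneg Delta_XiD(1) p_nonneg)

lemma T_pos:
  assumes "q \<in> Delta_Xi \<Xi>" "0 < q $ s $ i"
  shows "0 < T p q $ snd i"
  using T_ge[OF assms(1), of s "fst i" "snd i"] mult_pos_pos[OF p_pos[of s] assms(2)] by simp

text \<open>If the marginal of a positive point vanishes at \<open>b\<close>, then no support
  contains a pair with second coordinate \<open>b\<close>, so every admissible \<open>x\<close>
  vanishes on that column.\<close>

lemma T_abs_cont:
  assumes "x \<in> Delta_Xi \<Xi>" "y \<in> pos_points" "T p y $ b = 0"
  shows "T p x $ b = 0"
proof -
  have "x $ s $ (a, b) = 0" for s a
    using T_pos[OF pos_points_Delta[OF assms(2)], of s "(a, b)"] assms(3)
      pos_points_pos[OF assms(2), of "(a, b)" s] Delta_XiD(3)[OF assms(1), of "(a, b)" s] by auto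
  then show ?thesis by (simp add: T_def)
qed

lemma sum_T_Delta:
  assumes "q \<in> Delta_Xi \<Xi>"
  shows "(\<Sum>b\<in>UNIV. T p q $ b) = (\<Sum>s\<in>UNIV. p $ s)"
  using sum_T[of p q "\<lambda>_. 1"] by (simp add: Delta_XiD(5)[OF assms])

lemma kl_T_nonneg:
  assumes "x \<in> Delta_Xi \<Xi>" "y \<in> pos_points"
  shows "0 \<le> kl (T p x) (T p y)"
  using assms(1) pos_points_Delta[OF assms(2)] T_abs_cont[OF assms]
  by (intro kl_nonneg) (simp_all add: T_nonneg sum_T_Delta)

lemma Dkl_T_eq:
  assumes "x \<in> Delta_Xi \<Xi>" "y \<in> pos_points"
  shows "Dkl (T p x) (T p y) = ereal (kl (T p x) (T p y))"
  using assms(1) pos_points_Delta[OF assms(2)] T_abs_cont[OF assms]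
  by (intro Dkl_eq_kl) (simp_all add: T_nonneg)

lemma kl_component_nonneg:
  assumes "x \<in> Delta_Xi \<Xi>" "y \<in> pos_points"
  shows "0 \<le> kl (x $ s) (y $ s)"
  using assms(1) pos_points_Delta[OF assms(2)] pos_points_abs_cont[OF assms]
  by (intro kl_nonneg) (auto simp: Delta_XiD)

lemma divergence_nonneg:
  assumes "x \<in> Delta_Xi \<Xi>" "y \<in> pos_points"
  shows "0 \<le> divergence x y"
  unfolding divergence_def
  using kl_component_nonneg[OF assms] p_nonneg by (intro sum_nonneg mult_nonneg_nonneg)

lemma divergence_eq_Dkl:
  assumes "x \<in> Delta_Xi \<Xi>" "y \<in> pos_points"
  shows "(\<Sum>s\<in>UNIV. ereal (p $ s) * Dkl (x $ s) (y $ s)) = ereal (divergence x y)"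
proof -
  have "Dkl (x $ s) (y $ s) = ereal (kl (x $ s) (y $ s))" for s
    using assms(1) pos_points_Delta[OF assms(2)] pos_points_abs_cont[OF assms]
    by (intro Dkl_eq_kl) (auto simp: Delta_XiD)
  then show ?thesis by (simp add: divergence_def)
qed

lemma square_le_divergence:
  assumes "x \<in> Delta_Xi \<Xi>" "y \<in> pos_points"
  shows "p $ s * (x $ s $ i - y $ s $ i)\<^sup>2 \<le> 4 * divergence x y"
proof -
  have "p $ s * (x $ s $ i - y $ s $ i)\<^sup>2 \<le> p $ s * (4 * kl (x $ s) (y $ s))"
    using assms(1) pos_points_Delta[OF assms(2)] pos_points_abs_cont[OF assms]
    by (intro mult_left_mono square_le_kl p_nonneg) (auto simp: Delta_XiD)
  moreover have "p $ s * kl (x $ s) (y $ s) \<le> divergence x y"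
    unfolding divergence_def using kl_component_nonneg[OF assms] p_nonneg
    by (intro member_le_sum[of s UNIV "\<lambda>s. p $ s * kl (x $ s) (y $ s)"]) auto
  ultimately show ?thesis by simp
qed

text \<open>Data processing: passing to the marginal cannot increase relative entropy. For each
  \<open>b\<close> it is the log-sum inequality over the pairs \<open>(a, s)\<close>.\<close>

lemma kl_T_le_divergence:
  assumes x: "x \<in> Delta_Xi \<Xi>" and y: "y \<in> pos_points"
  shows "kl (T p x) (T p y) \<le> divergence x y"
proof -
  \<comment> \<open>One sum over \<open>j = (a, s)\<close> lets the log-sum inequality apply once
    per \<open>b\<close>; the factors \<open>p\<close> cancel in the ratios.\<close>
  have T_eq: "T p q $ b = (\<Sum>j\<in>UNIV. p $ snd j * q $ snd j $ (fst j, b))" for q :: "(real ^ ('a \<times> 'b)) ^ 's" and b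
    by (simp add: T_def sum_UNIV_prod)
  have "kl (T p x) (T p y) \<le> (\<Sum>b\<in>UNIV. \<Sum>j\<in>UNIV. p $ snd j * x $ snd j $ (fst j, b)
      * ln ((p $ snd j * x $ snd j $ (fst j, b)) / (p $ snd j * y $ snd j $ (fst j, b))))"
    unfolding kl_def T_eq
    using Delta_XiD(1)[OF x] Delta_XiD(1)[OF pos_points_Delta[OF y]] pos_points_abs_cont[OF x y]
    by (intro sum_mono log_sum_inequality) (auto simp: p_nonneg p_nonzero)
  also have "\<dots> = (\<Sum>b\<in>UNIV. \<Sum>a\<in>UNIV. \<Sum>s\<in>UNIV. p $ s * (x $ s $ (a, b) * ln (x $ s $ (a, b) / y $ s $ (a, b))))"
    by (simp add: sum_UNIV_prod p_nonzero mult.assoc)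
  also have "\<dots> = (\<Sum>a\<in>UNIV. \<Sum>s\<in>UNIV. \<Sum>b\<in>UNIV. p $ s * (x $ s $ (a, b) * ln (x $ s $ (a, b) / y $ s $ (a, b))))"
    by (subst sum.swap, intro sum.cong refl, subst sum.swap, rule refl)
  also have "\<dots> = (\<Sum>s\<in>UNIV. \<Sum>a\<in>UNIV. \<Sum>b\<in>UNIV. p $ s * (x $ s $ (a, b) * ln (x $ s $ (a, b) / y $ s $ (a, b))))"
    by (rule sum.swap)
  also have "\<dots> = divergence x y"
    by (simp add: divergence_def kl_def sum_UNIV_prod sum_distrib_left)
  finally show ?thesis .
qed

section \<open>The real-valued objective and existence of minimizers\<close>

lemma F_eq:
  assumes q: "q \<in> Delta_Xi \<Xi>"
  shows "F p \<Xi> d q \<eta> = ereal (f q)"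
proof -
  \<comment> \<open>A positive coordinate makes its marginal positive, so \<open>psi\<close> never
    takes its infinite branch.\<close>
  have "psi (q $ s $ (a, b)) (T p q $ b) = ereal (q $ s $ (a, b) * ln (q $ s $ (a, b) / T p q $ b))" for s a b
    using T_nonneg[OF q] Delta_XiD(1)[OF q] T_pos[OF q, of s "(a, b)"]
    by (intro psi_eq_real) (auto simp: less_le)
  moreover have "(\<Sum>a'\<in>UNIV. \<Sum>s'\<in>UNIV. p $ s' * q $ s' $ (a', b)) = T p q $ b" for b
    by (simp add: T_def)
  ultimately have g: "g p q = ereal (\<Sum>s\<in>UNIV. p $ s * (\<Sum>i\<in>UNIV. q $ s $ i * ln (q $ s $ i / T p q $ snd i)))"
    using Delta_XiD(1)[OF q] by (simp add: g_def sum_UNIV_prod)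
  have "p $ s * (\<Sum>i\<in>UNIV. q $ s $ i * cost s i) = \<eta> * (\<Sum>(a, b)\<in>\<Xi> s. d s a b * q $ s $ (a, b))" for s
  proof -
    have "(\<Sum>(a, b)\<in>\<Xi> s. d s a b * q $ s $ (a, b)) = (\<Sum>i\<in>UNIV. d s (fst i) (snd i) * q $ s $ i)"
      using Delta_XiD(3)[OF q] by (intro sum.mono_neutral_cong_left) auto
    then show ?thesis
      using p_pos[of s] by (simp add: cost_def sum_distrib_left field_simps)
  qed
  then have "(\<Sum>s\<in>UNIV. p $ s * (\<Sum>i\<in>UNIV. q $ s $ i * cost s i))
      = \<eta> * (\<Sum>s\<in>UNIV. \<Sum>(a, b)\<in>\<Xi> s. d s a b * q $ s $ (a, b))"
    by (simp add: sum_distrib_left)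
  then show ?thesis
    by (simp add: F_def g f_def Phi_def distrib_left sum.distrib)
qed

text \<open>Splitting the logarithm of the ratio leaves only expressions \<open>t * ln t\<close> in
  coordinates and marginals. These are continuous up to 0, unlike the ratio itself where the
  marginal vanishes.\<close>

lemma f_eq:
  assumes q: "q \<in> Delta_Xi \<Xi>"
  shows "f q = (\<Sum>s\<in>UNIV. p $ s * (\<Sum>i\<in>UNIV. q $ s $ i * ln (q $ s $ i) + q $ s $ i * cost s i))
      - (\<Sum>b\<in>UNIV. T p q $ b * ln (T p q $ b))"
proof -
  have "q $ s $ i * (ln (q $ s $ i / T p q $ snd i) + cost s i)
      = q $ s $ i * ln (q $ s $ i) + q $ s $ i * cost s i - q $ s $ i * ln (T p q $ snd i)" for s i
  proof (cases "q $ s $ i = 0")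
    case False
    then have "0 < q $ s $ i" using Delta_XiD(1)[OF q, of s i] by simp
    with T_pos[OF q this] show ?thesis by (simp add: ln_div algebra_simps)
  qed simp
  then show ?thesis
    by (simp add: f_def Phi_def sum_T sum_subtractf right_diff_distrib)
qed

lemma continuous_on_f: "continuous_on (Delta_Xi \<Xi>) f"
proof -
  have comp: "continuous_on (Delta_Xi \<Xi>) (\<lambda>q. h q * ln (h q))"
    if "continuous_on (Delta_Xi \<Xi>) h" "\<And>q. q \<in> Delta_Xi \<Xi> \<Longrightarrow> 0 \<le> h q"
    for h :: "(real ^ ('a \<times> 'b)) ^ 's \<Rightarrow> real"
    by (rule continuous_on_compose2[OF continuous_on_x_ln_x that(1)]) (use that(2) in auto)
  have q: "continuous_on (Delta_Xi \<Xi>) (\<lambda>q. q $ s $ i)" for s i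
    by (intro continuous_intros)
  have T: "continuous_on (Delta_Xi \<Xi>) (\<lambda>q. T p q $ b)" for b
    unfolding T_def vec_lambda_beta by (intro continuous_intros)
  have "continuous_on (Delta_Xi \<Xi>) (\<lambda>q. (\<Sum>s\<in>UNIV. p $ s * (\<Sum>i\<in>UNIV. q $ s $ i * ln (q $ s $ i) + q $ s $ i * cost s i))
      - (\<Sum>b\<in>UNIV. T p q $ b * ln (T p q $ b)))"
    using T_nonneg Delta_XiD(1)
    by (intro continuous_on_diff continuous_on_sum continuous_on_add continuous_on_mult_left
        continuous_on_mult_right comp q T)
  then show ?thesis
    using f_eq continuous_on_cong[OF refl, of "Delta_Xi \<Xi>" f] by (metis (no_types, lifting))
qed

lemma solutions_eq:
  "solutions p \<Xi> d \<eta> = {q \<in> Delta_Xi \<Xi>. \<forall>x\<in>Delta_Xi \<Xi>. f q \<le> f x}"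
  by (auto simp: solutions_def is_arg_min_def F_eq not_less)

lemma Delta_Xi_nonempty: "Delta_Xi \<Xi> \<noteq> {}"
proof -
  have "(\<chi> s. \<chi> i. if i \<in> \<Xi> s then 1 / real (card (\<Xi> s)) else 0) \<in> Delta_Xi \<Xi>"
    by (rule Delta_XiI) (use \<Xi>_nonempty in auto)
  then show ?thesis by blast
qed

lemma solutions_nonempty: "solutions p \<Xi> d \<eta> \<noteq> {}"
  using continuous_attains_inf[OF compact_Delta_Xi Delta_Xi_nonempty continuous_on_f]
  by (auto simp: solutions_eq)

section \<open>The Gibbs step and the three-point identity\<close>

lemma weight_pos:
  assumes "y \<in> pos_points" "i \<in> \<Xi> s"
  shows "0 < weight (T p y) s i"
  using T_pos[OF pos_points_Delta[OF assms(1)] pos_points_pos[OF assms]] by (simp add: weight_def)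

lemma Z_pos: "y \<in> pos_points \<Longrightarrow> 0 < Z (T p y) s"
  unfolding Z_def using weight_pos \<Xi>_nonempty by (intro sum_pos) auto

lemma step_pos_points:
  assumes y: "y \<in> pos_points"
  shows "step y \<in> pos_points"
proof -
  have "step y \<in> Delta_Xi \<Xi>"
  proof (rule Delta_XiI)
    show "0 \<le> step y $ s $ i" for s i
      using weight_pos[OF y, of i s] Z_pos[OF y, of s] by (auto simp: step_def less_imp_le)
    show "i \<notin> \<Xi> s \<Longrightarrow> step y $ s $ i = 0" for s i
      by (simp add: step_def)
    show "(\<Sum>i\<in>\<Xi> s. step y $ s $ i) = 1" for s
      using Z_pos[OF y, of s] by (simp add: step_def Z_def flip: sum_divide_distrib)
  qed
  then show ?thesis
    using weight_pos[OF y] Z_pos[OF y] by (simp add: pos_points_def step_def)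
qed

text \<open>Gibbs variational principle: on the support, \<open>ln\<close> of the step is
  \<open>ln\<close> of the marginal of \<open>y\<close> minus \<open>cost\<close> minus
  \<open>ln Z\<close>. As each \<open>x $ s\<close> has mass 1, the \<open>Z\<close> terms add up to
  a constant independent of \<open>x\<close>.\<close>

lemma Phi_eq_divergence_step:
  assumes x: "x \<in> Delta_Xi \<Xi>" and y: "y \<in> pos_points"
  shows "Phi (T p y) x = divergence x (step y) - (\<Sum>s\<in>UNIV. p $ s * ln (Z (T p y) s))"
proof -
  have "x $ s $ i * (ln (x $ s $ i / T p y $ snd i) + cost s i)
      = x $ s $ i * ln (x $ s $ i / step y $ s $ i) - x $ s $ i * ln (Z (T p y) s)" for s i
  proof (cases "x $ s $ i = 0")
    case False
    then have "0 < x $ s $ i" "i \<in> \<Xi> s"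
      using Delta_XiD(1)[OF x, of s i] Delta_XiD(3)[OF x, of i s] by auto
    moreover from y \<open>i \<in> \<Xi> s\<close> have "0 < T p y $ snd i"
      by (intro T_pos pos_points_Delta pos_points_pos)
    ultimately show ?thesis
      using Z_pos[OF y, of s] by (simp add: step_def weight_def ln_div ln_mult algebra_simps)
  qed simp
  then show ?thesis
    by (simp add: Phi_def divergence_def kl_def sum_subtractf right_diff_distrib Delta_XiD(5)[OF x]
        flip: sum_distrib_right)
qed

text \<open>Insert the marginal of \<open>x\<close> between numerator and denominator of the ratio.
  The extra logarithm depends on \<open>b\<close> alone, so \<open>sum_T\<close> turns it into
  \<open>kl\<close> of the marginals.\<close>

lemma Phi_eq_kl:
  assumes x: "x \<in> Delta_Xi \<Xi>" and y: "y \<in> pos_points"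
  shows "Phi (T p y) x = f x + kl (T p x) (T p y)"
proof -
  have "x $ s $ i * (ln (x $ s $ i / T p y $ snd i) + cost s i)
      = x $ s $ i * (ln (x $ s $ i / T p x $ snd i) + cost s i) + x $ s $ i * ln (T p x $ snd i / T p y $ snd i)" for s i
  proof (cases "x $ s $ i = 0")
    case False
    then have xi: "0 < x $ s $ i" "i \<in> \<Xi> s"
      using Delta_XiD(1)[OF x, of s i] Delta_XiD(3)[OF x, of i s] by auto
    have "0 < T p y $ snd i" "0 < T p x $ snd i"
      using xi x y by (auto intro: T_pos pos_points_Delta pos_points_pos)
    with xi show ?thesis
      by (simp add: ln_div algebra_simps)
  qed simp
  then show ?thesis
    by (simp add: f_def Phi_def kl_def sum_T sum.distrib distrib_left)
qed

text \<open>Equate the two expressions for \<open>Phi (T p y)\<close>, once at \<open>x\<close> and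
  once at \<open>step y\<close>. The \<open>Z\<close> constant cancels and the divergence of
  \<open>step y\<close> from itself is 0.\<close>

lemma three_point_identity:
  assumes x: "x \<in> Delta_Xi \<Xi>" and y: "y \<in> pos_points"
  shows "f x + kl (T p x) (T p y) = f (step y) + kl (T p (step y)) (T p y) + divergence x (step y)"
  using Phi_eq_kl[OF x y] Phi_eq_divergence_step[OF x y]
    Phi_eq_kl[OF pos_points_Delta[OF step_pos_points[OF y]] y]
    Phi_eq_divergence_step[OF pos_points_Delta[OF step_pos_points[OF y]] y]
  by (simp add: divergence_def)

lemma f_step_decrease:
  assumes x: "x \<in> Delta_Xi \<Xi>" and y: "y \<in> pos_points"
  shows "f (step y) - f x + kl (T p (step y)) (T p y) \<le> divergence x y - divergence x (step y)"
  using three_point_identity[OF x y] kl_T_le_divergence[OF x y] by linarith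

text \<open>Take \<open>x = y\<close> in the three-point identity: \<open>kl\<close> on the left
  vanishes and both extra terms on the right are nonnegative.\<close>

lemma f_step_le:
  assumes y: "y \<in> pos_points"
  shows "f (step y) \<le> f y"
  using three_point_identity[OF pos_points_Delta[OF y] y] step_pos_points[OF y] y
    kl_T_nonneg[of "step y" y] divergence_nonneg[of y "step y"]
  by (simp add: pos_points_Delta)

section \<open>Divergence and convergence\<close>

lemma tendsto_divergence_self:
  assumes "y \<longlonglongrightarrow> x"
  shows "(\<lambda>n. divergence x (y n)) \<longlonglongrightarrow> 0"
proof -
  have "(\<lambda>n. p $ s * kl (x $ s) (y n $ s)) \<longlonglongrightarrow> p $ s * 0" for s
    by (intro tendsto_mult tendsto_const tendsto_kl_self tendsto_vec_nth assms)
  then have "(\<lambda>n. divergence x (y n)) \<longlonglongrightarrow> (\<Sum>s\<in>UNIV. p $ s * 0)"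
    unfolding divergence_def by (rule tendsto_sum)
  then show ?thesis by simp
qed

lemma tendsto_of_divergence:
  assumes x: "x \<in> Delta_Xi \<Xi>" and y: "\<And>n. y n \<in> pos_points"
    and lim: "(\<lambda>n. divergence x (y n)) \<longlonglongrightarrow> 0"
  shows "y \<longlonglongrightarrow> x"
proof (intro vec_tendstoI)
  fix s i
  have lim': "(\<lambda>n. 4 * divergence x (y n) / p $ s) \<longlonglongrightarrow> 0"
    using tendsto_divide[OF tendsto_mult[OF tendsto_const[of 4] lim] tendsto_const p_nonzero[of s]]
    by simp
  have "(x $ s $ i - y n $ s $ i)\<^sup>2 \<le> 4 * divergence x (y n) / p $ s" for n
    using square_le_divergence[OF x y, of s i n] p_pos[of s] by (simp add: field_simps)
  then have "(\<lambda>n. (x $ s $ i - y n $ s $ i)\<^sup>2) \<longlonglongrightarrow> 0"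
    by (intro tendsto_sandwich[OF _ _ tendsto_const lim']) (auto intro!: always_eventually)
  then have "(\<lambda>n. sqrt ((x $ s $ i - y n $ s $ i)\<^sup>2)) \<longlonglongrightarrow> sqrt 0"
    by (rule tendsto_real_sqrt)
  then have "(\<lambda>n. x $ s $ i - y n $ s $ i) \<longlonglongrightarrow> 0"
    by (simp add: tendsto_rabs_zero_iff)
  then have "(\<lambda>n. x $ s $ i - (x $ s $ i - y n $ s $ i)) \<longlonglongrightarrow> x $ s $ i - 0"
    by (intro tendsto_diff tendsto_const)
  then show "(\<lambda>n. y n $ s $ i) \<longlonglongrightarrow> x $ s $ i" by simp
qed

section \<open>Rate and convergence of the iterates\<close>

context
  fixes q :: "nat \<Rightarrow> (real ^ ('a \<times> 'b)) ^ 's"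
  assumes start: "q 0 \<in> pos_points" and iterate: "\<And>n. q (Suc n) = step (q n)"
begin

lemma iterate_pos_points: "q n \<in> pos_points"
  by (induction n) (simp_all add: start iterate step_pos_points)

lemma iterate_Delta: "q n \<in> Delta_Xi \<Xi>"
  by (rule pos_points_Delta[OF iterate_pos_points])

text \<open>Telescoping \<open>f_step_decrease\<close> controls the sum of the gaps; as
  \<open>f\<close> decreases along the iterates, \<open>n\<close> times the last gap is no larger.
  The comparison point \<open>x\<close> is arbitrary because the cluster point is later compared
  with all competitors.\<close>

lemma iterate_bound:
  assumes x: "x \<in> Delta_Xi \<Xi>"
  shows "real n * (f (q n) - f x) + (\<Sum>k<n. kl (T p (q (Suc k))) (T p (q k)))
    \<le> divergence x (q 0) - divergence x (q n)"
proof (induction n)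
  case (Suc n)
  have "real n * (f (q (Suc n)) - f x) \<le> real n * (f (q n) - f x)"
    using f_step_le[OF iterate_pos_points[of n]] by (intro mult_left_mono) (simp_all add: iterate)
  moreover have "real (Suc n) * (f (q (Suc n)) - f x)
      = real n * (f (q (Suc n)) - f x) + (f (q (Suc n)) - f x)"
    by (simp add: algebra_simps)
  ultimately show ?case
    using Suc f_step_decrease[OF x iterate_pos_points[of n]] iterate[of n] by simp
qed simp

lemma kl_iterate_nonneg: "0 \<le> kl (T p (q m)) (T p (q n))"
  by (rule kl_T_nonneg[OF iterate_Delta iterate_pos_points])

lemma f_iterate_le:
  assumes x: "x \<in> Delta_Xi \<Xi>" and "0 < n"
  shows "f (q n) - f x \<le> divergence x (q 0) / real n"
proof -
  have "0 \<le> (\<Sum>k<n. kl (T p (q (Suc k))) (T p (q k)))"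
    by (intro sum_nonneg kl_iterate_nonneg)
  then have "real n * (f (q n) - f x) \<le> divergence x (q 0)"
    using iterate_bound[OF x, of n] divergence_nonneg[OF x iterate_pos_points[of n]] by linarith
  with \<open>0 < n\<close> show ?thesis by (simp add: field_simps)
qed

text \<open>Against a minimizer the gap term in \<open>iterate_bound\<close> is nonnegative, so the
  initial divergence bounds all partial sums.\<close>

lemma summable_kl_iterate: "summable (\<lambda>k. kl (T p (q (Suc k))) (T p (q k)))"
proof -
  obtain x where x: "x \<in> Delta_Xi \<Xi>" "\<And>y. y \<in> Delta_Xi \<Xi> \<Longrightarrow> f x \<le> f y"
    using solutions_nonempty by (auto simp: solutions_eq)
  have "(\<Sum>k<n. kl (T p (q (Suc k))) (T p (q k))) \<le> divergence x (q 0)" for n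
  proof -
    have "0 \<le> real n * (f (q n) - f x)"
      using x(2)[OF iterate_Delta] by simp
    then show ?thesis
      using iterate_bound[OF x(1), of n] divergence_nonneg[OF x(1) iterate_pos_points[of n]] by linarith
  qed
  \<comment> \<open>The summability criterion uses sums over \<open>k \<le> n\<close>, hence the
    bound at \<open>Suc n\<close>.\<close>
  from this[of "Suc n" for n] show ?thesis
    unfolding lessThan_Suc_atMost by (rule bounded_imp_summable[OF kl_iterate_nonneg])
qed

lemma iterate_converges: "\<exists>x\<in>solutions p \<Xi> d \<eta>. q \<longlonglongrightarrow> x"
proof -
  obtain x r where x: "x \<in> Delta_Xi \<Xi>" and r: "strict_mono r" and lim: "(q \<circ> r) \<longlonglongrightarrow> x"
    using compact_Delta_Xi[of \<Xi>] iterate_Delta unfolding compact_def by blast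
  \<comment> \<open>The cluster point is a minimizer: let \<open>n\<close> tend to infinity in the
    rate estimate along the subsequence.\<close>
  have "f x \<le> f y" if y: "y \<in> Delta_Xi \<Xi>" for y
  proof -
    have "(\<lambda>n. f (q (r n)) - f y) \<longlonglongrightarrow> f x - f y"
      using continuous_on_f x iterate_Delta lim
      by (intro tendsto_diff tendsto_const) (auto simp: continuous_on_sequentially o_def)
    moreover have "(\<lambda>n. divergence y (q 0) / real (r n)) \<longlonglongrightarrow> 0"
      using LIMSEQ_subseq_LIMSEQ[OF lim_const_over_n[of "divergence y (q 0)"] r] by (simp add: o_def)
    moreover have "\<exists>N. \<forall>n\<ge>N. f (q (r n)) - f y \<le> divergence y (q 0) / real (r n)"
    \<comment> \<open>The threshold is 1: \<open>r n \<ge> n \<ge> 1\<close> makes the rate estimate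
      applicable.\<close>
    proof (intro exI allI impI)
      fix n :: nat assume "1 \<le> n"
      also have "n \<le> r n" by (rule seq_suble[OF r])
      finally show "f (q (r n)) - f y \<le> divergence y (q 0) / real (r n)"
        by (intro f_iterate_le y) simp
    qed
    ultimately have "f x - f y \<le> 0" by (rule LIMSEQ_le)
    then show ?thesis by simp
  qed
  then have sol: "x \<in> solutions p \<Xi> d \<eta>"
    using x by (simp add: solutions_eq)
  \<comment> \<open>Fejer monotonicity: for a minimizer \<open>x\<close>, the gap and the marginal
    term in \<open>f_step_decrease\<close> are both nonnegative.\<close>
  have "divergence x (q (Suc n)) \<le> divergence x (q n)" for n
    using f_step_decrease[OF x iterate_pos_points[of n]] kl_iterate_nonneg[of "Suc n" n]
      \<open>\<And>y. y \<in> Delta_Xi \<Xi> \<Longrightarrow> f x \<le> f y\<close>[OF iterate_Delta[of "Suc n"]] iterate[of n] by simp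
  then have "decseq (\<lambda>n. divergence x (q n))"
    by (simp add: decseq_Suc_iff)
  then obtain L where L: "(\<lambda>n. divergence x (q n)) \<longlonglongrightarrow> L"
    using decseq_convergent[of _ 0] divergence_nonneg[OF x iterate_pos_points] by metis
  \<comment> \<open>Monotonicity gives a limit \<open>L\<close> along the full sequence; the
    subsequence converging to \<open>x\<close> identifies it as 0.\<close>
  have "(\<lambda>n. divergence x (q (r n))) \<longlonglongrightarrow> L"
    using LIMSEQ_subseq_LIMSEQ[OF L r] by (simp add: o_def)
  moreover have "(\<lambda>n. divergence x (q (r n))) \<longlonglongrightarrow> 0"
    using tendsto_divergence_self[OF lim] by (simp add: o_def)
  ultimately have "L = 0" by (rule LIMSEQ_unique)
  with L have "q \<longlonglongrightarrow> x"
    by (intro tendsto_of_divergence x iterate_pos_points) simp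
  with sol show ?thesis by blast
qed

end

section \<open>Transfer to the extended-real formulation\<close>

lemma step_eqI:
  assumes "x \<in> point_space \<Xi>"
    and "\<And>s a b. (a, b) \<in> \<Xi> s \<Longrightarrow> x $ s $ (a, b) = T p y $ b * exp (- (\<eta> * d s a b / p $ s)) /
            (\<Sum>(a', b')\<in>\<Xi> s. T p y $ b' * exp (- (\<eta> * d s a' b' / p $ s)))"
  shows "x = step y"
  \<comment> \<open>Off the supports both sides vanish, the left one by membership in
    \<open>point_space\<close>.\<close>
  using assms
  by (auto simp: vec_eq_iff step_def Z_def weight_def cost_def point_space_def case_prod_unfold)

end

theorem theorem3p1:
  fixes p :: "real ^ 's::finite"
    and \<Xi> :: "'s \<Rightarrow> ('a::finite \<times> 'b::finite) set"
    and d :: "'s \<Rightarrow> 'a \<Rightarrow> 'b \<Rightarrow> real"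
    and \<eta> :: real
  assumes "CARD('a) \<ge> 2"
    and "p \<in> Delta UNIV"
    and "\<forall>s. p $ s > 0"
    and "\<forall>s. \<Xi> s \<noteq> {}"
    and "\<eta> \<ge> 0"
  shows "solutions p \<Xi> d \<eta> \<noteq> {} \<and>
    (\<forall>q :: nat \<Rightarrow> (real ^ ('a \<times> 'b)) ^ 's.
       q 0 \<in> rel_interior (Delta_Xi \<Xi>) \<and>
       (\<forall>n. q n \<in> point_space \<Xi>) \<and>
       (\<forall>n s a b. (a, b) \<in> \<Xi> s \<longrightarrow>
          q (n + 1) $ s $ (a, b) =
            T p (q n) $ b * exp (- (\<eta> * d s a b / p $ s)) /
            (\<Sum>(a', b')\<in>\<Xi> s. T p (q n) $ b' * exp (- (\<eta> * d s a' b' / p $ s)))) \<longrightarrow>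
       (\<forall>qbar \<in> solutions p \<Xi> d \<eta>. \<forall>n.
          0 \<le> ereal (real n) * (F p \<Xi> d (q n) \<eta> - F p \<Xi> d qbar \<eta>)
                + (\<Sum>k<n. Dkl (T p (q (k + 1))) (T p (q k))) \<and>
          ereal (real n) * (F p \<Xi> d (q n) \<eta> - F p \<Xi> d qbar \<eta>)
                + (\<Sum>k<n. Dkl (T p (q (k + 1))) (T p (q k)))
            \<le> (\<Sum>s\<in>UNIV. ereal (p $ s) * Dkl (qbar $ s) (q 0 $ s))) \<and>
       (\<forall>qbar \<in> solutions p \<Xi> d \<eta>. \<forall>n\<ge>1.
          0 \<le> F p \<Xi> d (q n) \<eta> - F p \<Xi> d qbar \<eta> \<and>
          F p \<Xi> d (q n) \<eta> - F p \<Xi> d qbar \<eta>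
            \<le> ereal (1 / real n) * (\<Sum>s\<in>UNIV. ereal (p $ s) * Dkl (qbar $ s) (q 0 $ s))) \<and>
       summable (\<lambda>k. Dkl (T p (q (k + 2))) (T p (q (k + 1)))) \<and>
       (\<Sum>k. Dkl (T p (q (k + 2))) (T p (q (k + 1)))) < \<infinity> \<and>
       (\<exists>qbar \<in> solutions p \<Xi> d \<eta>. q \<longlonglongrightarrow> qbar))"
proof -
  interpret rate_problem p \<Xi> d \<eta>
    by unfold_locales (use assms in auto)
  show ?thesis
  proof (intro conjI allI impI solutions_nonempty)
    fix q :: "nat \<Rightarrow> (real ^ ('a \<times> 'b)) ^ 's"
    assume "q 0 \<in> rel_interior (Delta_Xi \<Xi>) \<and> (\<forall>n. q n \<in> point_space \<Xi>) \<and>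
       (\<forall>n s a b. (a, b) \<in> \<Xi> s \<longrightarrow>
          q (n + 1) $ s $ (a, b) =
            T p (q n) $ b * exp (- (\<eta> * d s a b / p $ s)) /
            (\<Sum>(a', b')\<in>\<Xi> s. T p (q n) $ b' * exp (- (\<eta> * d s a' b' / p $ s))))"
    then have ri: "q 0 \<in> rel_interior (Delta_Xi \<Xi>)" and space: "\<And>n. q n \<in> point_space \<Xi>"
      and rec: "\<And>n s a b. (a, b) \<in> \<Xi> s \<Longrightarrow> q (n + 1) $ s $ (a, b) =
            T p (q n) $ b * exp (- (\<eta> * d s a b / p $ s)) /
            (\<Sum>(a', b')\<in>\<Xi> s. T p (q n) $ b' * exp (- (\<eta> * d s a' b' / p $ s)))"
      by blast+
    have start: "q 0 \<in> pos_points"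
      using ri rel_interior_subset rel_interior_Delta_Xi_pos[OF \<Xi>_nonempty ri]
      unfolding pos_points_def by blast
    have iterate: "q (Suc n) = step (q n)" for n
      by (rule step_eqI[OF space rec[of _ _ _ n, simplified]])
    note pos = iterate_pos_points[of q, OF start iterate]
      and Delta = iterate_Delta[of q, OF start iterate]
      and bound = iterate_bound[of q, OF start iterate]
      and f_le = f_iterate_le[of q, OF start iterate]
    have F: "F p \<Xi> d (q n) \<eta> = ereal (f (q n))" for n
      by (rule F_eq[OF Delta])
    have Dkl: "Dkl (T p (q m)) (T p (q n)) = ereal (kl (T p (q m)) (T p (q n)))" for m n
      by (rule Dkl_T_eq[OF Delta pos])
    have kl: "0 \<le> kl (T p (q m)) (T p (q n))" for m n
      by (rule kl_T_nonneg[OF Delta pos])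
    show "\<forall>x\<in>solutions p \<Xi> d \<eta>. \<forall>n.
          0 \<le> ereal (real n) * (F p \<Xi> d (q n) \<eta> - F p \<Xi> d x \<eta>)
                + (\<Sum>k<n. Dkl (T p (q (k + 1))) (T p (q k))) \<and>
          ereal (real n) * (F p \<Xi> d (q n) \<eta> - F p \<Xi> d x \<eta>)
                + (\<Sum>k<n. Dkl (T p (q (k + 1))) (T p (q k)))
            \<le> (\<Sum>s\<in>UNIV. ereal (p $ s) * Dkl (x $ s) (q 0 $ s))"
    proof (intro ballI allI)
      fix x n assume "x \<in> solutions p \<Xi> d \<eta>"
      then have x: "x \<in> Delta_Xi \<Xi>" and le: "f x \<le> f (q n)"
        using Delta by (auto simp: solutions_eq)
      have "0 \<le> real n * (f (q n) - f x) + (\<Sum>k<n. kl (T p (q (Suc k))) (T p (q k)))"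
        using le by (intro add_nonneg_nonneg mult_nonneg_nonneg sum_nonneg kl) auto
      \<comment> \<open>The final divergence subtracted in \<open>iterate_bound\<close> is
        nonnegative and is dropped.\<close>
      moreover have "real n * (f (q n) - f x) + (\<Sum>k<n. kl (T p (q (Suc k))) (T p (q k))) \<le> divergence x (q 0)"
        using bound[OF x, of n] divergence_nonneg[OF x pos[of n]] by linarith
      ultimately show "0 \<le> ereal (real n) * (F p \<Xi> d (q n) \<eta> - F p \<Xi> d x \<eta>)
                + (\<Sum>k<n. Dkl (T p (q (k + 1))) (T p (q k))) \<and>
          ereal (real n) * (F p \<Xi> d (q n) \<eta> - F p \<Xi> d x \<eta>)
                + (\<Sum>k<n. Dkl (T p (q (k + 1))) (T p (q k)))
            \<le> (\<Sum>s\<in>UNIV. ereal (p $ s) * Dkl (x $ s) (q 0 $ s))"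
        by (simp add: F F_eq[OF x] Dkl divergence_eq_Dkl[OF x start])
    qed
    show "\<forall>x\<in>solutions p \<Xi> d \<eta>. \<forall>n\<ge>1. 0 \<le> F p \<Xi> d (q n) \<eta> - F p \<Xi> d x \<eta> \<and>
          F p \<Xi> d (q n) \<eta> - F p \<Xi> d x \<eta>
            \<le> ereal (1 / real n) * (\<Sum>s\<in>UNIV. ereal (p $ s) * Dkl (x $ s) (q 0 $ s))"
    proof (intro ballI allI impI)
      fix x and n :: nat assume "x \<in> solutions p \<Xi> d \<eta>" and n: "1 \<le> n"
      then have x: "x \<in> Delta_Xi \<Xi>" and le: "f x \<le> f (q n)"
        using Delta by (auto simp: solutions_eq)
      show "0 \<le> F p \<Xi> d (q n) \<eta> - F p \<Xi> d x \<eta> \<and>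
          F p \<Xi> d (q n) \<eta> - F p \<Xi> d x \<eta>
            \<le> ereal (1 / real n) * (\<Sum>s\<in>UNIV. ereal (p $ s) * Dkl (x $ s) (q 0 $ s))"
        using f_le[OF x, of n] le n by (simp add: F F_eq[OF x] divergence_eq_Dkl[OF x start])
    qed
    have "summable (\<lambda>k. kl (T p (q (Suc (Suc k)))) (T p (q (Suc k))))"
      \<comment> \<open>The series in the claim starts at index 1, hence the shift by one.\<close>
      using summable_Suc_iff[THEN iffD2, OF summable_kl_iterate[of q, OF start iterate]] .
    then have sums: "(\<lambda>k. Dkl (T p (q (k + 2))) (T p (q (k + 1)))) sums
        ereal (\<Sum>k. kl (T p (q (Suc (Suc k)))) (T p (q (Suc k))))"
      by (simp add: Dkl sums_ereal summable_sums)
    show "summable (\<lambda>k. Dkl (T p (q (k + 2))) (T p (q (k + 1))))"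
      using sums by (rule sums_summable)
    show "(\<Sum>k. Dkl (T p (q (k + 2))) (T p (q (k + 1)))) < \<infinity>"
      unfolding sums_unique[OF sums, symmetric] by simp
    show "\<exists>x\<in>solutions p \<Xi> d \<eta>. q \<longlonglongrightarrow> x"
      by (rule iterate_converges[of q, OF start iterate])
  qed
qed

end
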